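(* Let $U:=\langle s_{12},s_{13},s_{23}\rangle\le\Lambda$. The stabilizer $\mathrm{GL}_4(\mathbb K)_U$ coincides with the stabilizer of the subspace $\langle b_1,b_2,b_3\rangle$ of $\mathbb K^4$. Thus $$\mathrm{GL}_4(\mathbb K)_U=\left\{\begin{pmatrix} a & 0 \\ b & C \end{pmatrix}\ \middle|\ a\in\mathbb K\setminus\{0\},\ b\in\mathbb K^3,\ C\in\mathrm{GL}_3(\mathbb K)\right\}.$$ Its orbits on $\mathbb K^4$ are represented by $0$, $b_1$, $b_0$, and those on $\Lambda/U$ are represented by $U$, $s_{01}+U$.
   Context: $\mathbb K$ is an arbitrary field; $X'$ denotes the transpose of a matrix $X$; $b_0,b_1,b_2,b_3$ is the standard basis of $\mathbb K^4$ (column vectors). $\Lambda=\mathbb K^4\wedge\mathbb K^4$ is the space of skew-symmetric $4\times4$ matrices over $\mathbb K$ with zero diagonal, and $s_{jk}:=b_jb_k'-b_kb_j'$ for $0\le j<k\le3$. The group $\mathrm{GL}_4(\mathbb K)$ acts on $\mathbb K^4$ naturally and on $\Lambda$ by $M.X:=MXM'$. For $U\le\Lambda$, $\mathrm{GL}_4(\mathbb K)_U$ is the stabilizer of $U$ under this action; it acts on $\Lambda/U$. $\langle\cdots\rangle$ denotes $\mathbb K$-span. (The space $U$ is denoted $J(F)$ in the paper.) "The orbits are represented by" a list means that each orbit contains exactly one member of the list. *)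

theory Defs
  imports
    "HOL-Analysis.Analysis"
    "HOL-Algebra.Group_Action"
    "HOL-Library.Set_Algebras"
begin

definition scale_mat :: "'k::field \<Rightarrow> 'k^'n^'m \<Rightarrow> 'k^'n^'m"
  where "scale_mat c A = (\<chi> i j. c * A $ i $ j)"

interpretation mat: vector_space scale_mat
  by unfold_locales (simp_all add: scale_mat_def vec_eq_iff algebra_simps)

text \<open>The four elements of the index type \<^typ>\<open>4\<close> are 0, 1, 2, 3, so the standard basis of
  the column space is indexed as usual.\<close>

definition bvec :: "4 \<Rightarrow> 'k::field^4"
  where "bvec j = axis j 1"

definition s :: "4 \<Rightarrow> 4 \<Rightarrow> 'k::field^4^4"
  where "s j k =
    (columnvector (bvec j) :: 'k^1^4) ** transpose (columnvector (bvec k) :: 'k^1^4)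
    - (columnvector (bvec k) :: 'k^1^4) ** transpose (columnvector (bvec j) :: 'k^1^4)"

text \<open>The condition on the diagonal is redundant except in characteristic two.\<close>

definition Lambda :: "('k::field^4^4) set"
  where "Lambda = {X. transpose X = - X \<and> (\<forall>i. X $ i $ i = 0)}"

definition GL :: "('k::field^'n^'n) monoid"
  where "GL = \<lparr>carrier = {M. invertible M}, mult = (**), one = mat 1\<rparr>"

lemma group_GL: "group (GL :: ('k::field^'n^'n) monoid)"
proof (rule groupI)
  fix M :: "'k^'n^'n" assume "M \<in> carrier GL"
  then obtain N where "M ** N = mat 1" "N ** M = mat 1"
    by (auto simp: GL_def invertible_def)
  then show "\<exists>N \<in> carrier GL. N \<otimes>\<^bsub>GL\<^esub> M = \<one>\<^bsub>GL\<^esub>"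
    by (intro bexI[of _ N]) (auto simp: GL_def invertible_def)
qed (auto simp: GL_def invertible_mult matrix_mul_assoc invertible_def[of "mat 1"])

definition act :: "'k::field^4^4 \<Rightarrow> 'k^4^4 \<Rightarrow> 'k^4^4"
  where "act M X = M ** X ** transpose M"

text \<open>Set stabilizers: the induced actions on subsets are by taking images.\<close>

definition stab_Lambda :: "('k::field^4^4) set \<Rightarrow> ('k^4^4) set"
  where "stab_Lambda U = stabilizer GL (\<lambda>M. (`) (act M)) U"

definition stab_vec :: "('k::field^4) set \<Rightarrow> ('k^4^4) set"
  where "stab_vec W = stabilizer GL (\<lambda>M. (`) ((*v) M)) W"

definition GL_stab :: "('k::field^4^4) set \<Rightarrow> ('k^4^4) monoid"
  where "GL_stab U = GL\<lparr>carrier := stab_Lambda U\<rparr>"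

text \<open>The quotient space consists of the cosets of \<open>U\<close>. For \<open>M\<close> in the stabilizer of \<open>U\<close>, the
  image of the coset of \<open>X\<close> under \<open>act M\<close> is the coset of \<open>act M X\<close>, so \<open>quot_act\<close> is the
  induced action on the quotient.\<close>

definition Lambda_quot :: "('k::field^4^4) set \<Rightarrow> ('k^4^4) set set"
  where "Lambda_quot U = (\<lambda>X. X +o U) ` Lambda"

definition quot_act :: "'k::field^4^4 \<Rightarrow> ('k^4^4) set \<Rightarrow> ('k^4^4) set"
  where "quot_act M = (`) (act M)"

definition orbits_represented_by ::
  "('g, 'm) monoid_scheme \<Rightarrow> 'x set \<Rightarrow> ('g \<Rightarrow> 'x \<Rightarrow> 'x) \<Rightarrow> 'x list \<Rightarrow> bool"
  where "orbits_represented_by G E \<phi> rs \<longleftrightarrow>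
    distinct rs \<and> set rs \<subseteq> E \<and> (\<forall>B \<in> orbits G E \<phi>. \<exists>!r. r \<in> set rs \<and> r \<in> B)"

text \<open>The block matrix with rows \<open>(a 0)\<close> and \<open>(b C)\<close>. The rows and columns 1, 2, 3 of the result
  correspond to the indices 0, 1, 2 of type \<^typ>\<open>3\<close>; \<open>low 0\<close> is never used.\<close>

definition low :: "4 \<Rightarrow> 3"
  where "low i = (if i = 1 then 0 else if i = 2 then 1 else 2)"

definition lower_block :: "'k::field \<Rightarrow> 'k^3 \<Rightarrow> 'k^3^3 \<Rightarrow> 'k^4^4"
  where "lower_block a b C = (\<chi> i j.
    if i = 0 then (if j = 0 then a else 0)
    else if j = 0 then b $ low i
    else C $ low i $ low j)"

end

theory Submission
  imports Defs
begin

text \<open>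
  Membership in \<open>U\<close>, in \<open>\<langle>b\<^sub>1, b\<^sub>2, b\<^sub>3\<rangle>\<close> and in the group of block matrices are all
  conditions on row \<open>0\<close>. If \<open>M\<close> stabilizes \<open>U\<close>, then row \<open>0\<close> of \<open>M.s\<^sub>j\<^sub>k\<close> says that
  \<open>M\<^sub>0\<^sub>j\<close> times column \<open>k\<close> equals \<open>M\<^sub>0\<^sub>k\<close> times column \<open>j\<close>, so \<open>M\<^sub>0\<^sub>j = M\<^sub>0\<^sub>k = 0\<close> because
  the columns of \<open>M\<close> are independent. A coset \<open>X + U\<close> is determined by the vector
  \<open>w = (X\<^sub>0\<^sub>1, X\<^sub>0\<^sub>2, X\<^sub>0\<^sub>3)\<close>, on which a block matrix acts by \<open>w \<mapsto> a C w\<close>. Both orbit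
  statements then follow from the transitivity of \<open>GL\<^sub>3\<close> on nonzero vectors.
\<close>

section \<open>Indices and block matrices\<close>

lemma zero_eq_4: "(4::4) = 0"
  by simp

text \<open>The library expansions use the numeral 4, which is 0 in the type \<open>4\<close>; here
  the indices are those of the standard basis.\<close>

lemma sum_UNIV_4: "sum f (UNIV :: 4 set) = f 0 + f 1 + f 2 + f 3"
  by (simp add: sum_4 zero_eq_4 ac_simps)

lemma all_4: "(\<forall>i::4. P i) \<longleftrightarrow> P 0 \<and> P 1 \<and> P 2 \<and> P 3"
  unfolding forall_4 zero_eq_4 by blast

lemma zero_eq_3: "(3::3) = 0"
  by simp

lemma all_3: "(\<forall>i::3. P i) \<longleftrightarrow> P 0 \<and> P 1 \<and> P 2"
  unfolding forall_3 zero_eq_3 by blast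

lemma sum_UNIV_3: "sum f (UNIV :: 3 set) = f 0 + f 1 + f 2"
  by (simp add: sum_3 zero_eq_3 ac_simps)

lemma low_simps [simp]: "low 1 = 0" "low 2 = 1" "low 3 = 2"
  by (simp_all add: low_def)

text \<open>Inverse of \<open>low\<close> on the indices 1, 2, 3; it reads off the blocks of a given
  matrix.\<close>

definition up :: "3 \<Rightarrow> 4"
  where "up i = (if i = 0 then 1 else if i = 1 then 2 else 3)"

lemma up_simps [simp]: "up 0 = 1" "up 1 = 2" "up 2 = 3"
  by (simp_all add: up_def)

lemma lower_block_nth [simp]:
  "lower_block a b C $ 0 $ 0 = a"
  "j \<noteq> 0 \<Longrightarrow> lower_block a b C $ 0 $ j = 0"
  "i \<noteq> 0 \<Longrightarrow> lower_block a b C $ i $ 0 = b $ low i"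
  "i \<noteq> 0 \<Longrightarrow> j \<noteq> 0 \<Longrightarrow> lower_block a b C $ i $ j = C $ low i $ low j"
  by (simp_all add: lower_block_def)

lemma s_nth: "s j k $ i $ l = axis j 1 $ i * axis k 1 $ l - axis k 1 $ i * axis j 1 $ l"
  by (simp add: s_def bvec_def matrix_matrix_mult_def transpose_def columnvector_def)

lemma act_nth: "act M X $ i $ j = (\<Sum>k\<in>UNIV. \<Sum>l\<in>UNIV. M $ i $ k * X $ k $ l * M $ j $ l)"
  unfolding act_def matrix_matrix_mult_def transpose_def
  by (simp add: sum_distrib_right) (rule sum.swap)

lemma mult_bvec_nth: "(M *v bvec j) $ i = M $ i $ j"
  by (simp add: bvec_def matrix_vector_mult_def axis_def if_distrib cong: if_cong)

lemma lower_block_mult: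
  "lower_block a b C ** lower_block a' b' C' = lower_block (a * a') (a' *s b + C *v b') (C ** C')"
  by (simp add: vec_eq_iff all_4 matrix_matrix_mult_def matrix_vector_mult_def sum_UNIV_4 sum_UNIV_3
      ac_simps)

lemma lower_block_one: "lower_block 1 0 (mat 1) = mat 1"
  by (simp add: vec_eq_iff all_4 mat_def)

lemma lower_block_inject: "lower_block a b C = lower_block a' b' C' \<longleftrightarrow> a = a' \<and> b = b' \<and> C = C'"
  by (auto simp: vec_eq_iff all_4 all_3)

lemma lower_block_exhaust:
  assumes "M $ 0 $ 1 = 0" "M $ 0 $ 2 = 0" "M $ 0 $ 3 = 0"
  obtains a b C where "M = lower_block a b C"
proof
  show "M = lower_block (M $ 0 $ 0) (\<chi> i. M $ up i $ 0) (\<chi> i j. M $ up i $ up j)"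
    using assms by (simp add: vec_eq_iff all_4)
qed

definition lower_blocks :: "('k::field^4^4) set"
  where "lower_blocks = {lower_block a b C | a b C. a \<noteq> 0 \<and> invertible C}"

lemma lower_block_in_lower_blocks: "lower_block a b C \<in> lower_blocks \<longleftrightarrow> a \<noteq> 0 \<and> invertible C"
  by (auto simp: lower_blocks_def lower_block_inject)

lemma mat_1_in_lower_blocks: "mat 1 \<in> lower_blocks"
  unfolding lower_block_one [symmetric] lower_block_in_lower_blocks by (auto simp: invertible_def)

lemma lower_blocks_inverse:
  assumes "M \<in> lower_blocks"
  obtains N where "N \<in> lower_blocks" "M ** N = mat 1" "N ** M = mat 1"
proof -
  obtain a b C where M: "M = lower_block a b C" and a: "a \<noteq> 0" and C: "invertible C"
    using assms by (auto simp: lower_blocks_def)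
  then obtain D where D: "C ** D = mat 1" "D ** C = mat 1"
    by (auto simp: invertible_def)
  \<comment> \<open>By \<open>lower_block_mult\<close>, the lower left block b' of a right inverse
    has to satisfy (1/a) b + C b' = 0, hence b' = -(1/a) D b.\<close>
  let ?N = "lower_block (1 / a) (- (1 / a) *s (D *v b)) D"
  have "invertible D" using D by (auto simp: invertible_def)
  with a have "?N \<in> lower_blocks" by (simp add: lower_block_in_lower_blocks)
  moreover have "M ** ?N = mat 1"
    using a D by (simp add: M lower_block_mult lower_block_one [symmetric] lower_block_inject
        vec.scale matrix_vector_mul_assoc vec.neg)
  moreover have "?N ** M = mat 1"
    using a D by (simp add: M lower_block_mult lower_block_one [symmetric] lower_block_inject)
  ultimately show ?thesis by (rule that)
qed

text \<open>For the harder inclusion, row 0 of M N is \<open>M $ 0 $ 0\<close> times row 0 of N. So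
  the inverse N is block triangular as well, and its lower right block inverts that of M.\<close>

lemma lower_blocks_eq:
  "lower_blocks = {M. invertible M \<and> M $ 0 $ 1 = 0 \<and> M $ 0 $ 2 = 0 \<and> M $ 0 $ 3 = 0}"
proof (intro equalityI subsetI)
  fix M :: "'a^4^4" assume "M \<in> lower_blocks"
  moreover from this have "invertible M" unfolding invertible_def by (blast elim: lower_blocks_inverse)
  ultimately show "M \<in> {M. invertible M \<and> M $ 0 $ 1 = 0 \<and> M $ 0 $ 2 = 0 \<and> M $ 0 $ 3 = 0}"
    by (auto simp: lower_blocks_def)
next
  fix M :: "'a^4^4"
  assume "M \<in> {M. invertible M \<and> M $ 0 $ 1 = 0 \<and> M $ 0 $ 2 = 0 \<and> M $ 0 $ 3 = 0}"
  then obtain N where z: "M $ 0 $ 1 = 0" "M $ 0 $ 2 = 0" "M $ 0 $ 3 = 0"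
    and N: "M ** N = mat 1" "N ** M = mat 1"
    by (auto simp: invertible_def)
  have row: "M $ 0 $ 0 * N $ 0 $ j = (if j = 0 then 1 else 0)" for j
    using arg_cong [OF N(1), of "\<lambda>A. A $ 0 $ j"] z
    by (auto simp: matrix_matrix_mult_def sum_UNIV_4 mat_def)
  have a: "M $ 0 $ 0 \<noteq> 0" using row [of 0] by auto
  then have "N $ 0 $ 1 = 0" "N $ 0 $ 2 = 0" "N $ 0 $ 3 = 0"
    using row [of 1] row [of 2] row [of 3] by auto
  then obtain a' b' D where N': "N = lower_block a' b' D" by (rule lower_block_exhaust)
  from z obtain a b C where M': "M = lower_block a b C" by (rule lower_block_exhaust)
  have "C ** D = mat 1" "D ** C = mat 1"
    using N by (simp_all add: M' N' lower_block_mult lower_block_one [symmetric] lower_block_inject)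
  then have "invertible C" by (auto simp: invertible_def)
  with a M' show "M \<in> lower_blocks" by (auto simp: lower_blocks_def)
qed

section \<open>The hyperplane and the spaces \<open>Lambda\<close> and \<open>U\<close> in
  coordinates\<close>

lemma span_bvec_123: "vec.span {bvec 1, bvec 2, bvec 3 :: 'k::field^4} = {x. x $ 0 = 0}"
proof (intro equalityI subsetI)
  fix x :: "'k^4" assume "x \<in> {x. x $ 0 = 0}"
  then have "x = x $ 1 *s bvec 1 + x $ 2 *s bvec 2 + x $ 3 *s bvec 3"
    by (simp add: vec_eq_iff all_4 bvec_def axis_def)
  also have "\<dots> \<in> vec.span {bvec 1, bvec 2, bvec 3}"
    by (intro vec.span_add vec.span_scale vec.span_base) auto
  finally show "x \<in> vec.span {bvec 1, bvec 2, bvec 3}" .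
next
  fix x :: "'k^4" assume "x \<in> vec.span {bvec 1, bvec 2, bvec 3}"
  moreover have "vec.subspace {x :: 'k^4. x $ 0 = 0}" by (auto simp: vec.subspace_def)
  moreover have "{bvec 1, bvec 2, bvec 3} \<subseteq> {x :: 'k^4. x $ 0 = 0}"
    by (auto simp: bvec_def axis_def)
  ultimately show "x \<in> {x. x $ 0 = 0}" by (meson subsetD vec.span_minimal)
qed

text \<open>Solves for the entries on and below the diagonal, leaving six free entries, so that
  membership becomes a matter of simplification.\<close>

lemma Lambda_iff:
  "X \<in> Lambda \<longleftrightarrow> X $ 0 $ 0 = 0 \<and> X $ 1 $ 1 = 0 \<and> X $ 2 $ 2 = 0 \<and> X $ 3 $ 3 = 0
    \<and> X $ 1 $ 0 = - X $ 0 $ 1 \<and> X $ 2 $ 0 = - X $ 0 $ 2 \<and> X $ 3 $ 0 = - X $ 0 $ 3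
    \<and> X $ 2 $ 1 = - X $ 1 $ 2 \<and> X $ 3 $ 1 = - X $ 1 $ 3 \<and> X $ 3 $ 2 = - X $ 2 $ 3"
  by (auto simp: Lambda_def vec_eq_iff all_4 transpose_def)

lemma subspace_Lambda: "mat.subspace Lambda"
  by (auto simp: mat.subspace_def Lambda_iff scale_mat_def)

lemma s_in_Lambda: "s j k \<in> Lambda"
  by (simp add: Lambda_def vec_eq_iff transpose_def s_nth mult.commute)

lemma act_Lambda:
  assumes "X \<in> Lambda"
  shows "act M X \<in> Lambda"
  using assms by (simp add: Lambda_iff act_nth sum_UNIV_4 algebra_simps)

text \<open>Closed form of the span \<open>U\<close>, see \<open>span_s\<close>. The entry (0,0)
  vanishes throughout \<open>Lambda\<close>, so all of row 0 is zero here.\<close>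

definition U0 :: "('k::field^4^4) set"
  where "U0 = {X \<in> Lambda. X $ 0 $ 1 = 0 \<and> X $ 0 $ 2 = 0 \<and> X $ 0 $ 3 = 0}"

lemma subspace_U0: "mat.subspace U0"
  by (auto simp: mat.subspace_def U0_def Lambda_iff scale_mat_def)

lemma s_in_U0: "j \<noteq> 0 \<Longrightarrow> k \<noteq> 0 \<Longrightarrow> s j k \<in> U0"
  by (simp add: U0_def s_in_Lambda s_nth axis_def)

lemma span_s: "mat.span {s 1 2, s 1 3, s 2 3 :: 'k::field^4^4} = U0"
proof (intro equalityI subsetI)
  fix X :: "'k^4^4" assume "X \<in> U0"
  then have "X = scale_mat (X $ 1 $ 2) (s 1 2) + scale_mat (X $ 1 $ 3) (s 1 3)
      + scale_mat (X $ 2 $ 3) (s 2 3)"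
    by (auto simp: vec_eq_iff all_4 s_nth scale_mat_def axis_def U0_def Lambda_iff)
  also have "\<dots> \<in> mat.span {s 1 2, s 1 3, s 2 3}"
    by (intro mat.span_add mat.span_scale mat.span_base) auto
  finally show "X \<in> mat.span {s 1 2, s 1 3, s 2 3}" .
next
  fix X :: "'k^4^4" assume "X \<in> mat.span {s 1 2, s 1 3, s 2 3}"
  moreover have "{s 1 2, s 1 3, s 2 3} \<subseteq> (U0 :: ('k^4^4) set)"
    by (auto simp: s_in_U0)
  ultimately show "X \<in> U0" using mat.span_minimal [OF _ subspace_U0] by blast
qed

section \<open>The action on \<open>Lambda\<close> and the two stabilizers\<close>

lemma act_act: "act M (act N X) = act (M ** N) X"
  by (simp add: act_def matrix_transpose_mul matrix_mul_assoc)

lemma act_one: "act (mat 1) X = X"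
  by (simp add: act_def)

lemma act_add: "act M (X + Y) = act M X + act M Y"
  by (simp add: vec_eq_iff act_nth algebra_simps sum.distrib)

text \<open>If m_j denotes column j of M, then M.s_jk = m_j m_k' - m_k m_j'.\<close>

lemma act_s_row_0: "act M (s j k) $ 0 $ i = M $ 0 $ j * M $ i $ k - M $ 0 $ k * M $ i $ j"
proof -
  \<comment> \<open>Quantifying j and k lets \<open>all_4\<close> split the claim into sixteen cases
    with concrete indices.\<close>
  have "\<forall>j k. act M (s j k) $ 0 $ i = M $ 0 $ j * M $ i $ k - M $ 0 $ k * M $ i $ j"
    by (simp add: all_4 act_nth sum_UNIV_4 s_nth axis_def)
  then show ?thesis by blast
qed

text \<open>Row 0 of M vanishes off the diagonal, so only k = 0 survives in \<open>act_nth\<close>.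
  Hence row 0 of M.X depends on X only through its row 0.\<close>

lemma act_row_0:
  assumes "M \<in> lower_blocks"
  shows "act M X $ 0 $ i = M $ 0 $ 0 * (\<Sum>l\<in>UNIV. X $ 0 $ l * M $ i $ l)"
  using assms by (simp add: lower_blocks_eq act_nth sum_UNIV_4 algebra_simps)

lemma act_U0:
  assumes "M \<in> lower_blocks" "X \<in> U0"
  shows "act M X \<in> U0"
  using assms by (simp add: U0_def act_Lambda act_row_0 sum_UNIV_4) (simp add: Lambda_iff)

lemma row_0_eq_zero:
  assumes "invertible M" "act M (s j k) \<in> U0" "j \<noteq> k"
  shows "M $ 0 $ j = 0" "M $ 0 $ k = 0"
proof -
  from assms(1) obtain N where N: "N ** M = mat 1" by (auto simp: invertible_def)
  have 0: "M $ 0 $ j * M $ i $ k - M $ 0 $ k * M $ i $ j = 0" for i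
    using assms(2) all_4 [of "\<lambda>i. act M (s j k) $ 0 $ i = 0"]
    by (simp add: act_s_row_0 [symmetric] U0_def Lambda_iff)
  \<comment> \<open>Applying N to the relation between columns j and k of M turns them into columns
    of the identity; l = k and l = j then isolate the two coefficients.\<close>
  have *: "M $ 0 $ j * (N ** M) $ l $ k - M $ 0 $ k * (N ** M) $ l $ j = 0" for l
  proof -
    have "M $ 0 $ j * (N ** M) $ l $ k - M $ 0 $ k * (N ** M) $ l $ j
        = (\<Sum>i\<in>UNIV. N $ l $ i * (M $ 0 $ j * M $ i $ k - M $ 0 $ k * M $ i $ j))"
      by (simp add: matrix_matrix_mult_def sum_distrib_left sum_subtractf algebra_simps)
    then show ?thesis by (simp only: 0) simp
  qed
  show "M $ 0 $ j = 0" "M $ 0 $ k = 0"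
    using *[of k] *[of j] assms(3) by (auto simp: N mat_def)
qed

lemma stab_Lambda_U0: "stab_Lambda U0 = (lower_blocks :: ('k::field^4^4) set)"
proof (intro equalityI subsetI)
  fix M :: "'k^4^4" assume "M \<in> stab_Lambda U0"
  then have inv: "invertible M" and U: "act M ` U0 = U0"
    by (auto simp: stab_Lambda_def stabilizer_def GL_def)
  \<comment> \<open>Between them these two generators involve the columns 1, 2 and 3, so
    \<open>row_0_eq_zero\<close> yields all three zeros.\<close>
  have "act M (s 1 2) \<in> U0" "act M (s 1 3) \<in> U0" using U by (auto simp: s_in_U0)
  from row_0_eq_zero [OF inv this(1)] row_0_eq_zero [OF inv this(2)] inv
  show "M \<in> lower_blocks" by (simp add: lower_blocks_eq)
next
  fix M :: "'k^4^4" assume M: "M \<in> lower_blocks"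
  then obtain N where N: "N \<in> lower_blocks" "M ** N = mat 1" by (rule lower_blocks_inverse)
  \<comment> \<open>The stabilizer requires equality of sets; the reverse inclusion holds because
    the inverse N preserves \<open>U0\<close> too.\<close>
  have "act M ` U0 = U0"
  proof (intro equalityI subsetI)
    fix X :: "'k^4^4" assume "X \<in> U0"
    then have "act N X \<in> U0" "X = act M (act N X)" using N by (simp_all add: act_U0 act_act act_one)
    then show "X \<in> act M ` U0" by blast
  qed (use M in \<open>auto simp: act_U0\<close>)
  with M show "M \<in> stab_Lambda U0"
    by (simp add: stab_Lambda_def stabilizer_def GL_def lower_blocks_eq)
qed

text \<open>The image of b_j is column j of M, so stability puts columns 1, 2, 3 into the
  hyperplane. The converse again uses the inverse.\<close>

lemma stab_vec_hyperplane: "stab_vec {x. x $ 0 = 0} = (lower_blocks :: ('k::field^4^4) set)"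
proof (intro equalityI subsetI)
  fix M :: "'k^4^4" assume "M \<in> stab_vec {x. x $ 0 = 0}"
  then have inv: "invertible M" and W: "(*v) M ` {x. x $ 0 = 0} = {x. x $ 0 = 0}"
    by (auto simp: stab_vec_def stabilizer_def GL_def)
  have "M $ 0 $ j = 0" if "j \<noteq> 0" for j
  proof -
    have "M *v bvec j \<in> {x. x $ 0 = 0}" using W that by (auto simp: bvec_def axis_def)
    then show ?thesis by (simp add: mult_bvec_nth)
  qed
  with inv show "M \<in> lower_blocks" by (simp add: lower_blocks_eq)
next
  fix M :: "'k^4^4" assume M: "M \<in> lower_blocks"
  then obtain N where N: "N \<in> lower_blocks" "M ** N = mat 1" by (rule lower_blocks_inverse)
  have stable: "(A *v x) $ 0 = 0" if "A \<in> lower_blocks" "x $ 0 = 0" for A :: "'k^4^4" and x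
    using that by (simp add: lower_blocks_eq matrix_vector_mult_def sum_UNIV_4)
  have "(*v) M ` {x. x $ 0 = 0} = {x. x $ 0 = 0}"
  proof (intro equalityI subsetI)
    fix x :: "'k^4" assume "x \<in> {x. x $ 0 = 0}"
    then have "(N *v x) $ 0 = 0" "x = M *v (N *v x)"
      using N by (simp_all add: stable matrix_vector_mul_assoc)
    then show "x \<in> (*v) M ` {x. x $ 0 = 0}" by blast
  qed (use M in \<open>auto simp: stable\<close>)
  with M show "M \<in> stab_vec {x. x $ 0 = 0}"
    by (simp add: stab_vec_def stabilizer_def GL_def lower_blocks_eq)
qed

section \<open>Orbits on the column space\<close>

lemma orbits_represented_byI:
  assumes "distinct rs" "set rs \<subseteq> E" "inj_on c (set rs)"
    and "\<And>g x. g \<in> carrier G \<Longrightarrow> x \<in> E \<Longrightarrow> c (\<phi> g x) = c x"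
    and "\<And>x. x \<in> E \<Longrightarrow> \<exists>g \<in> carrier G. \<phi> g x \<in> set rs"
  shows "orbits_represented_by G E \<phi> rs"
  unfolding orbits_represented_by_def
proof (intro conjI ballI)
  fix B assume "B \<in> orbits G E \<phi>"
  then obtain x where x: "x \<in> E" and B: "B = {\<phi> g x | g. g \<in> carrier G}"
    by (auto simp: orbits_def orbit_def)
  from assms(5) [OF x] obtain g where "g \<in> carrier G" "\<phi> g x \<in> set rs" by blast
  then show "\<exists>!r. r \<in> set rs \<and> r \<in> B"
  proof (intro ex1I [of _ "\<phi> g x"])
    fix r assume "r \<in> set rs \<and> r \<in> B"
    \<comment> \<open>Both r and \<open>\<phi> g x\<close> lie in the orbit of x, so the invariant c
      has the same value on them; it separates the members of the list.\<close>
    with \<open>g \<in> carrier G\<close> have "r \<in> set rs" "c r = c (\<phi> g x)" using x B by (auto simp: assms(4))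
    then show "r = \<phi> g x" using assms(3) \<open>\<phi> g x \<in> set rs\<close> by (auto dest: inj_onD)
  qed (use B in auto)
qed (use assms(1,2) in auto)

text \<open>The remaining columns are the two standard basis vectors that avoid a nonzero entry of
  v, so the determinant is that entry up to sign.\<close>

lemma invertible_with_first_column:
  fixes v :: "'k::field^3"
  assumes "v \<noteq> 0"
  obtains C :: "'k^3^3" where "invertible C" "\<And>i. C $ i $ 0 = v $ i"
proof -
  have "v $ 0 \<noteq> 0 \<or> v $ 1 \<noteq> 0 \<or> v $ 2 \<noteq> 0" using assms by (simp add: vec_eq_iff all_3)
  then consider "v $ 0 \<noteq> 0" | "v $ 1 \<noteq> 0" | "v $ 2 \<noteq> 0" by blast
  then show ?thesis
  proof cases
    case 1
    show ?thesis
      by (rule that [of "\<chi> i j. if j = 0 then v $ i else if j = i then 1 else 0"])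
        (use 1 in \<open>simp_all add: invertible_det_nz det_3 zero_eq_3\<close>)
  next
    case 2
    show ?thesis
      \<comment> \<open>Index arithmetic is modulo 3: columns 1 and 2 are the basis vectors with
        indices 0 and 2.\<close>
      by (rule that [of "\<chi> i j. if j = 0 then v $ i else if i + j = 1 \<or> i = 2 \<and> j = 2 then 1 else 0"])
        (use 2 in \<open>simp_all add: invertible_det_nz det_3 zero_eq_3\<close>)
  next
    case 3
    show ?thesis
      \<comment> \<open>Here columns 1 and 2 are the basis vectors with indices 1 and 0.\<close>
      by (rule that [of "\<chi> i j. if j = 0 then v $ i else if i + j = 2 then 1 else 0"])
        (use 3 in \<open>simp_all add: invertible_det_nz det_3 zero_eq_3\<close>)
  qed
qed

text \<open>Serves both actions: M maps b_1 to x, and because the corner entry is 1, row 0 of M.s_01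
  is x as well.\<close>

lemma lower_blocks_with_column_1:
  fixes x :: "'k::field^4"
  assumes "x $ 0 = 0" "x \<noteq> 0"
  obtains M where "M \<in> lower_blocks" "M $ 0 $ 0 = 1" "\<And>i. M $ i $ 1 = x $ i"
proof -
  have "(\<chi> i. x $ up i) \<noteq> 0" using assms by (simp add: vec_eq_iff all_3 all_4)
  then obtain C :: "'k^3^3" where C: "invertible C" "\<And>i. C $ i $ 0 = x $ up i"
    using invertible_with_first_column [of "\<chi> i. x $ up i"] by auto
  show ?thesis
  proof (rule that)
    show "lower_block 1 0 C \<in> lower_blocks" using C(1) by (simp add: lower_block_in_lower_blocks)
    have "\<forall>i. lower_block 1 0 C $ i $ 1 = x $ i" using assms(1) C(2) by (simp add: all_4)
    then show "lower_block 1 0 C $ i $ 1 = x $ i" for i by blast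
  qed simp
qed

lemma lower_blocks_with_column_0:
  fixes x :: "'k::field^4"
  assumes "x $ 0 \<noteq> 0"
  obtains M where "M \<in> lower_blocks" "\<And>i. M $ i $ 0 = x $ i"
proof (rule that)
  let ?M = "lower_block (x $ 0) (\<chi> i. x $ up i) (mat 1)"
  show "?M \<in> lower_blocks" using assms by (auto simp: lower_block_in_lower_blocks invertible_def)
  have "\<forall>i. ?M $ i $ 0 = x $ i" by (simp add: all_4)
  then show "?M $ i $ 0 = x $ i" for i by blast
qed

lemma orbits_vec:
  assumes "carrier G = (lower_blocks :: ('k::field^4^4) set)"
  shows "orbits_represented_by G UNIV (*v) [0, bvec 1, bvec 0]"
proof (rule orbits_represented_byI)
  \<comment> \<open>Invariant because M is injective and (M x)_0 = M_00 x_0 with M_00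
    nonzero.\<close>
  let ?c = "\<lambda>x :: 'k^4. (x = 0, x $ 0 = 0)"
  show "distinct [0, bvec 1, bvec 0 :: 'k^4]"
    by (simp add: bvec_def axis_eq_axis axis_eq_0_iff eq_commute [of 0 "axis _ _"])
  show "inj_on ?c (set [0, bvec 1, bvec 0])"
    by (auto simp: inj_on_def bvec_def axis_def vec_eq_iff)
next
  fix M :: "'k^4^4" and x
  assume "M \<in> carrier G"
  then have M: "M \<in> lower_blocks" by (simp add: assms)
  then obtain N where N: "N ** M = mat 1" by (rule lower_blocks_inverse)
  have "M *v x = 0 \<longleftrightarrow> x = 0"
    by (metis N matrix_vector_mul_assoc matrix_vector_mul_lid matrix_vector_mult_0_right)
  moreover have "M $ 0 $ 0 \<noteq> 0" using M by (auto simp: lower_blocks_def)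
  then have "(M *v x) $ 0 = 0 \<longleftrightarrow> x $ 0 = 0"
    using M by (simp add: lower_blocks_eq matrix_vector_mult_def sum_UNIV_4)
  ultimately show "(M *v x = 0, (M *v x) $ 0 = 0) = (x = 0, x $ 0 = 0)" by simp
next
  fix x :: "'k^4"
  \<comment> \<open>It is easier to build a matrix that takes a representative to x; its inverse
    then takes x to the representative.\<close>
  have *: "\<exists>N \<in> carrier G. N *v x \<in> set [0, bvec 1, bvec 0]"
    if M: "M \<in> lower_blocks" "M *v r = x" "r \<in> set [0, bvec 1, bvec 0]" for M r
  proof -
    from M(1) obtain N where N: "N \<in> lower_blocks" "N ** M = mat 1" by (rule lower_blocks_inverse)
    then have "N *v x = r" using M(2) by (auto simp: matrix_vector_mul_assoc)
    with N M(3) show ?thesis by (auto simp: assms)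
  qed
  consider "x = 0" | "x $ 0 = 0" "x \<noteq> 0" | "x $ 0 \<noteq> 0" by blast
  then show "\<exists>N \<in> carrier G. N *v x \<in> set [0, bvec 1, bvec 0]"
  proof cases
    case 1
    show ?thesis by (rule * [OF mat_1_in_lower_blocks]) (auto simp: 1)
  next
    case 2
    then obtain M where "M \<in> lower_blocks" "\<And>i. M $ i $ 1 = x $ i"
      using lower_blocks_with_column_1 by blast
    then show ?thesis by (intro * [of M "bvec 1"]) (auto simp: vec_eq_iff mult_bvec_nth)
  next
    case 3
    then obtain M where "M \<in> lower_blocks" "\<And>i. M $ i $ 0 = x $ i"
      using lower_blocks_with_column_0 by blast
    then show ?thesis by (intro * [of M "bvec 0"]) (auto simp: vec_eq_iff mult_bvec_nth)
  qed
qed auto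

section \<open>Orbits on the quotient\<close>

lemma coset_U0:
  assumes "X \<in> Lambda"
  shows "X +o U0 = {Y \<in> Lambda. \<forall>i. Y $ 0 $ i = X $ 0 $ i}"
proof (intro equalityI subsetI)
  fix Y assume "Y \<in> X +o U0"
  then obtain Z where Z: "Z \<in> U0" "Y = X + Z" by (auto simp: elt_set_plus_def)
  with assms have "Y \<in> Lambda" using mat.subspace_add [OF subspace_Lambda] by (auto simp: U0_def)
  with Z show "Y \<in> {Y \<in> Lambda. \<forall>i. Y $ 0 $ i = X $ 0 $ i}"
    by (auto simp: all_4 U0_def Lambda_iff)
next
  fix Y assume Y: "Y \<in> {Y \<in> Lambda. \<forall>i. Y $ 0 $ i = X $ 0 $ i}"
  then have "Y - X \<in> Lambda" using assms mat.subspace_diff [OF subspace_Lambda] by auto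
  with Y have "Y - X \<in> U0" by (simp add: U0_def)
  then show "Y \<in> X +o U0" by (auto simp: elt_set_plus_def intro: bexI [of _ "Y - X"])
qed

text \<open>Row 0 thus provides coordinates on the quotient.\<close>

lemma coset_U0_eq_iff:
  assumes "X \<in> Lambda" "Y \<in> Lambda"
  shows "X +o U0 = Y +o U0 \<longleftrightarrow> (\<forall>i. X $ 0 $ i = Y $ 0 $ i)"
  using assms by (auto simp: coset_U0)

lemma act_U0_image:
  assumes "M \<in> lower_blocks"
  shows "act M ` U0 = U0"
  using assms by (simp add: stab_Lambda_U0 [symmetric] stab_Lambda_def stabilizer_def)

lemma quot_act_coset:
  assumes "M \<in> lower_blocks"
  shows "quot_act M (X +o U0) = act M X +o U0"
proof -
  have "act M ` (X +o U0) = act M X +o act M ` U0"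
    by (force simp: elt_set_plus_def act_add)
  with assms show ?thesis by (simp add: quot_act_def act_U0_image)
qed

lemma orbits_quot:
  assumes "carrier G = (lower_blocks :: ('k::field^4^4) set)"
  shows "orbits_represented_by G (Lambda_quot U0) quot_act [U0, s 0 1 +o U0]"
proof (rule orbits_represented_byI)
  let ?c = "\<lambda>A :: ('k^4^4) set. A = U0"
  have 0: "0 \<in> (Lambda :: ('k^4^4) set)" by (rule mat.subspace_0 [OF subspace_Lambda])
  have U: "0 +o U0 = (U0 :: ('k^4^4) set)" by (simp add: elt_set_plus_def)
  have ne: "s 0 1 +o U0 \<noteq> (U0 :: ('k^4^4) set)"
    using coset_U0_eq_iff [OF s_in_Lambda 0, of 0 1] by (auto simp: U s_nth axis_def)
  then show "distinct [U0, s 0 1 +o (U0 :: ('k^4^4) set)]" by auto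
  show "inj_on ?c (set [U0, s 0 1 +o U0])" using ne by (auto simp: inj_on_def)
  show "set [U0, s 0 1 +o U0] \<subseteq> Lambda_quot (U0 :: ('k^4^4) set)"
    using 0 U s_in_Lambda [of 0 1, where 'a = 'k] unfolding Lambda_quot_def by force
next
  fix M :: "'k^4^4" and A
  assume "M \<in> carrier G"
  then have M: "M \<in> lower_blocks" by (simp add: assms)
  then obtain N where N: "N ** M = mat 1" by (rule lower_blocks_inverse)
  \<comment> \<open>Since \<open>act M\<close> is injective and maps \<open>U0\<close> onto itself,
    no other set has image \<open>U0\<close>.\<close>
  have "inj (act M)" by (rule inj_on_inverseI [of _ "act N"]) (simp add: act_act N act_one)
  then show "(quot_act M A = U0) = (A = U0)"
    using inj_image_eq_iff [of "act M" A U0] by (simp add: quot_act_def act_U0_image M)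
next
  fix A :: "('k^4^4) set"
  assume "A \<in> Lambda_quot U0"
  then obtain X where X: "X \<in> Lambda" "A = X +o U0" by (auto simp: Lambda_quot_def)
  show "\<exists>N \<in> carrier G. quot_act N A \<in> set [U0, s 0 1 +o U0]"
  proof (cases "X $ 0 = 0")
    case True
    with X have "A = U0"
      using coset_U0_eq_iff [OF X(1) mat.subspace_0 [OF subspace_Lambda]] by simp
    with mat_1_in_lower_blocks show ?thesis
      by (auto simp: assms act_U0_image quot_act_def intro!: bexI [of _ "mat 1"])
  next
    case False
    \<comment> \<open>The prescribed column is row 0 of X, whose entry 0 vanishes because X has zero
      diagonal.\<close>
    then obtain M where M: "M \<in> lower_blocks" "M $ 0 $ 0 = 1" "\<And>i. M $ i $ 1 = X $ 0 $ i"
      using X by (auto simp: Lambda_iff elim: lower_blocks_with_column_1)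
    then obtain N where N: "N \<in> lower_blocks" "N ** M = mat 1" by (blast elim: lower_blocks_inverse)
    have "\<forall>i. act M (s 0 1) $ 0 $ i = X $ 0 $ i"
      using M by (simp add: act_s_row_0 lower_blocks_eq)
    with X have "act M (s 0 1) +o U0 = A"
      using coset_U0_eq_iff [OF act_Lambda [OF s_in_Lambda]] by blast
    then have "quot_act N A = s 0 1 +o U0"
      using N by (auto simp: quot_act_coset act_act act_one)
    with N show ?thesis by (auto simp: assms)
  qed
qed

theorem proposition4p6:
  fixes U :: "('k::field^4^4) set"
  assumes U_def: "U = mat.span {s 1 2, s 1 3, s 2 3}"
  shows "mat.subspace U \<and> U \<subseteq> Lambda
    \<and> stab_Lambda U = stab_vec (vec.span {bvec 1, bvec 2, bvec 3})
    \<and> stab_Lambda U = {lower_block a b C | a b C. a \<noteq> 0 \<and> invertible C}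
    \<and> orbits_represented_by (GL_stab U) UNIV (*v) [0, bvec 1, bvec 0]
    \<and> orbits_represented_by (GL_stab U) (Lambda_quot U) quot_act [U, s 0 1 +o U]"
proof -
  have U: "U = U0" by (simp add: U_def span_s)
  have G: "carrier (GL_stab U0 :: ('k^4^4) monoid) = lower_blocks"
    by (simp add: GL_stab_def stab_Lambda_U0)
  have "U0 \<subseteq> (Lambda :: ('k^4^4) set)" by (auto simp: U0_def)
  with subspace_U0 orbits_vec [OF G] orbits_quot [OF G] show ?thesis
    unfolding U span_bvec_123 stab_Lambda_U0 stab_vec_hyperplane
    by (simp add: lower_blocks_def)
qed

end
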